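(* Let $N$ be a positive integer, $\alpha>0$, and let $R:[N_0,\infty)\to(0,\infty)$ be a regular varying function with index $\beta\in\mathbb{R}$, where $0<N_0\le N$. Put $R_k=R(k)$ for integers $k\ge N$. Then there are constants $C,t_0>0$ such that $$\frac{1}{C}R(\alpha t)e^{\alpha t}\leq\sum_{k=N}^\infty\frac{(\alpha t)^k}{k!}R_k\leq C R(\alpha t)e^{\alpha t}\quad\text{for all } t\geq t_0 .$$ In particular, $\sum_{k=N}^\infty\frac{(\alpha t)^k}{k!}R_k\asymp R(\alpha t)e^{\alpha t}$ as $t\to\infty$.
   Context: A measurable function $R:[N_0,\infty)\to(0,\infty)$, where $N_0>0$, is called regular varying with index $\beta\in\mathbb{R}$ if $\lim_{s\to\infty}R(\lambda s)/R(s)=\lambda^\beta$ for all $\lambda>0$. The notation $f(t)\asymp g(t)$ as $t\to\infty$ means that there are constants $C,t_0>0$ with $\frac1C g(t)\le f(t)\le Cg(t)$ for all $t\ge t_0$. *)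

theory Defs
  imports "HOL-Analysis.Analysis"
begin

(* Functions on [a, \<infinity>) are represented by total functions on the reals whose values
   below a are irrelevant; in particular R (l * s) lies in the domain for all large s.
   Measurability is Lebesgue measurability of the restriction to [a, \<infinity>). *)
definition regularly_varying :: "real \<Rightarrow> real \<Rightarrow> (real \<Rightarrow> real) \<Rightarrow> bool" where
  "regularly_varying a \<beta> R \<longleftrightarrow>
     a > 0 \<and>
     R \<in> borel_measurable (lebesgue_on {a..}) \<and>
     (\<forall>s\<ge>a. R s > 0) \<and>
     (\<forall>l>0. ((\<lambda>s. R (l * s) / R s) \<longlongrightarrow> l powr \<beta>) at_top)"

definition same_order :: "(real \<Rightarrow> real) \<Rightarrow> (real \<Rightarrow> real) \<Rightarrow> bool" where
  "same_order f g \<longleftrightarrow>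
     (\<exists>C>0. \<exists>t0>0. \<forall>t\<ge>t0. (1 / C) * g t \<le> f t \<and> f t \<le> C * g t)"

end

theory Submission
  imports Defs
begin

text \<open>
  Put \<open>x = \<alpha> t\<close>.  Up to the factor \<open>exp x\<close>, the series is the mean of \<open>R k\<close> under a Poisson law of
  mean \<open>x\<close>, and the claim is that this mean is comparable to \<open>R x\<close>.

  Regular variation controls how far \<open>R k\<close> can be from \<open>R x\<close>.  For a measurable \<open>R\<close>, the ratio
  \<open>R (m s) / R s\<close> is bounded above and below uniformly in \<open>1 \<le> m \<le> 2\<close> for large \<open>s\<close>
  (\<open>regularly_varying_comparable_nearby\<close>, a measure-theoretic overlap argument of Steinhaus type).
  Iterating over doublings gives \<open>R k \<le> D \<phi> k R x\<close> and \<open>R x \<le> D \<phi> k R k\<close> with a polynomial weight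
  \<open>\<phi> k = (k / x) ^ p + (x / k) ^ p\<close> (\<open>regularly_varying_comparable_at_nats\<close>).  The exponent \<open>p\<close>
  depends on the doubling constant and need not be close to \<open>\<bar>\<beta>\<bar>\<close>; any polynomial bound suffices.

  The Poisson mean of \<open>\<phi>\<close> is bounded in \<open>x\<close> (\<open>poisson_moment_bound\<close>), which gives the upper
  estimate.  For the lower estimate, the mean of \<open>R k\<close> is at least \<open>R x / D\<close> times the mean of
  \<open>1 / \<phi>\<close>, and by convexity of \<open>1 / u\<close> a bounded mean of \<open>\<phi>\<close> forces the mean of \<open>1 / \<phi>\<close> to stay
  away from zero (\<open>poisson_sum_of_comparable\<close>).
\<close>


section \<open>Uniform comparability over bounded dilations\<close>

text \<open>
  Both \<open>A\<close> and \<open>m \<cdot> B\<close> lie in \<open>{1..4 m}\<close>, and the measures add up to more than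
  \<open>8/3 \<cdot> (1 + m) \<ge> 4 m - 1\<close> (the inequality holds for \<open>m \<le> 11/4\<close>), so the two sets cannot be
  disjoint.  The interval \<open>{1..4}\<close> is long enough that a dilation by at most 2 leaves a
  substantial overlap.
\<close>

lemma dilation_overlap:
  fixes A B :: "real set"
  assumes A: "A \<in> sets lebesgue" "A \<subseteq> {1..4}" "measure lebesgue A > 8/3"
    and B: "B \<in> sets lebesgue" "B \<subseteq> {1..4}" "measure lebesgue B > 8/3"
    and m: "1 \<le> m" "m \<le> 2"
  shows "\<exists>w\<in>B. m * w \<in> A"
proof (rule ccontr)
  assume neg: "\<not> ?thesis"
  let ?mB = "(\<lambda>x. m *\<^sub>R x + 0) ` B"
  have mB_eq: "?mB = (*\<^sub>R) (1/m) -` B \<inter> space lebesgue"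
    using m by (auto simp: image_iff field_simps) (metis mult.commute mult_cancel_right1 nonzero_mult_div_cancel_left not_one_le_zero times_divide_eq_left)
  have mB_sets: "?mB \<in> sets lebesgue"
    unfolding mB_eq by (rule measurable_sets[OF lebesgue_measurable_scaling B(1)])
  have fm: "A \<in> lmeasurable" "B \<in> lmeasurable"
    using A B by (auto intro!: fmeasurableI2[of "{1..4}" lebesgue])
  have sub: "A \<union> ?mB \<subseteq> {1..4*m}"
  proof -
    have "x \<le> 4 * m" if "x \<in> A" for x using A(2) that m by (smt (verit) atLeastAtMost_iff subsetD)
    moreover have "1 \<le> m * x \<and> m * x \<le> 4 * m" if "x \<in> B" for x
      using B(2) that m mult_mono[of 1 m 1 x] by (auto simp: mult.commute)
    ultimately show ?thesis using A(2) by auto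
  qed
  have mB_fm: "?mB \<in> lmeasurable"
    using mB_sets sub by (auto intro!: fmeasurableI2[of "{1..4*m}" lebesgue])
  have disj: "A \<inter> ?mB = {}" using neg by auto
  have "measure lebesgue (A \<union> ?mB) = measure lebesgue A + measure lebesgue ?mB"
    using fm mB_fm disj by (simp add: measure_Un3)
  also have "measure lebesgue ?mB = m * measure lebesgue B"
    using measure_lebesgue_affine[of m 0 B] m by simp
  finally have split: "measure lebesgue (A \<union> ?mB) = measure lebesgue A + m * measure lebesgue B" .
  have "A \<union> ?mB \<in> sets lebesgue" "{1..4*m} \<in> lmeasurable"
    using A(1) mB_sets by auto
  then have "measure lebesgue A + m * measure lebesgue B \<le> measure lebesgue {1..4*m}"
    using measure_mono_fmeasurable[OF sub] split by metis
  also have "\<dots> = 4*m - 1" using m by simp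
  finally have "measure lebesgue A + m * measure lebesgue B \<le> 4*m - 1" .
  moreover have "m * measure lebesgue B \<ge> m * (8/3)" using B m by (intro mult_left_mono) auto
  ultimately show False using A m by argo
qed

text \<open>
  This is the only place where measurability of \<open>R\<close> enters, and it turns the pointwise limit into
  a bound uniform in \<open>m\<close>.  For large \<open>s\<close>, most points \<open>l\<close> of \<open>{1..4}\<close> are good for \<open>s\<close>, in the
  sense that \<open>R (l * s)\<close> and \<open>R s\<close> agree up to a fixed factor.  By overlap, some good point \<open>w\<close>
  for \<open>m * s\<close> is such that \<open>m * w\<close> is good for \<open>s\<close>; then both \<open>R (m * s)\<close> and \<open>R s\<close> are
  comparable to \<open>R (m * w * s)\<close>.
\<close>

lemma regularly_varying_comparable_nearby:
  assumes rv: "regularly_varying a \<beta> R"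
  obtains K X where "K > 0" "X \<ge> a"
    "\<And>s m. \<lbrakk>s \<ge> X; 1 \<le> m; m \<le> 2\<rbrakk> \<Longrightarrow> R (m * s) \<le> K * R s \<and> R s \<le> K * R (m * s)"
proof -
  have a: "a > 0" and pos: "\<And>s. s \<ge> a \<Longrightarrow> R s > 0"
    and meas: "R \<in> borel_measurable (lebesgue_on {a..})"
    and lim: "\<And>l. l > 0 \<Longrightarrow> ((\<lambda>s. R (l * s) / R s) \<longlongrightarrow> l powr \<beta>) at_top"
    using rv by (auto simp: regularly_varying_def)
  \<comment> \<open>On \<open>{1..4}\<close>, \<open>l powr \<beta>\<close> lies in \<open>[2 / L, L / 2]\<close>; the factor 2 leaves room for the limit.\<close>
  define L where "L = 2 * 4 powr \<bar>\<beta>\<bar>"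
  have L: "L > 0" by (simp add: L_def)
  define A where "A = (\<lambda>s. {l \<in> {1..4}. R (l * s) \<le> L * R s \<and> R s \<le> L * R (l * s)})"
  have Asets: "A s \<in> sets lebesgue" if s: "s \<ge> a" for s
  proof -
    \<comment> \<open>Extension by zero makes the dilated function measurable on the whole line.\<close>
    define R' where "R' = (\<lambda>x. if x \<in> {a..} then R x else 0)"
    have R': "R' \<in> borel_measurable lebesgue"
      unfolding R'_def by (rule borel_measurable_if_I[OF meas]) simp
    have [measurable]: "(\<lambda>l. R' (s *\<^sub>R l)) \<in> borel_measurable lebesgue"
      using measurable_compose[OF lebesgue_measurable_scaling R'] by simp
    have [measurable]: "{1..4::real} \<in> sets lebesgue" by simp
    have "A s = {l \<in> space lebesgue. l \<in> {1..4} \<and> R' (s *\<^sub>R l) \<le> L * R s \<and> R s \<le> L * R' (s *\<^sub>R l)}"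
    proof -
      have "l * s \<ge> a" if "1 \<le> l" for l
        using s a mult_mono[of 1 l a s] that by auto
      then show ?thesis by (auto simp: A_def R'_def mult.commute)
    qed
    also have "\<dots> \<in> sets lebesgue" by measurable
    finally show ?thesis .
  qed
  have ev: "\<forall>\<^sub>F s in at_top. l \<in> A s" if l: "l \<in> {1..4}" for l
  proof -
    have "\<bar>\<beta>\<bar> * ln l \<le> \<bar>\<beta>\<bar> * ln 4" using l by (intro mult_left_mono) auto
    then have "\<bar>\<beta> * ln l\<bar> \<le> \<bar>\<beta>\<bar> * ln 4" using l by (simp add: abs_mult)
    then have "l powr \<beta> \<le> 4 powr \<bar>\<beta>\<bar>" "l powr (-\<beta>) \<le> 4 powr \<bar>\<beta>\<bar>"
      using l by (auto simp: powr_def)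
    then have u: "l powr \<beta> < L" and "l powr (-\<beta>) < L"
      by (auto simp: L_def intro: le_less_trans)
    then have lo: "1 / L < l powr \<beta>"
      using L l by (auto simp: powr_minus field_simps)
    have "\<forall>\<^sub>F s in at_top. R (l * s) / R s < L" "\<forall>\<^sub>F s in at_top. 1 / L < R (l * s) / R s"
      using order_tendstoD[OF lim[of l]] u lo l by auto
    then show ?thesis using eventually_ge_at_top[of a]
    proof eventually_elim
      case (elim s)
      then show ?case using pos[of s] L l by (auto simp: A_def field_simps)
    qed
  qed
  \<comment> \<open>The good sets fill up \<open>{1..4}\<close> in measure; \<open>max a s\<close> keeps them measurable for every \<open>s\<close>.\<close>
  have conv: "((\<lambda>s. integral\<^sup>L lebesgue (indicator (A (max a s)) :: real \<Rightarrow> real)) \<longlongrightarrow>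
          integral\<^sup>L lebesgue (indicator {1..4::real} :: real \<Rightarrow> real)) at_top"
  proof (rule integral_dominated_convergence_at_top[where w = "indicator {1..4}"])
    show "AE x in lebesgue. ((\<lambda>s. indicator (A (max a s)) x) \<longlongrightarrow> (indicator {1..4} x :: real)) at_top"
    proof (rule AE_I2)
      fix x :: real
      have "\<forall>\<^sub>F s in at_top. indicator (A (max a s)) x = (indicator {1..4} x :: real)"
      proof (cases "x \<in> {1..4}")
        case True
        show ?thesis using ev[OF True] eventually_ge_at_top[of a]
          by eventually_elim (use True in \<open>auto simp: max_def\<close>)
      next
        case False
        then show ?thesis by (auto simp: A_def indicator_def)
      qed
      then show "((\<lambda>s. indicator (A (max a s)) x) \<longlongrightarrow> (indicator {1..4} x :: real)) at_top"
        by (rule tendsto_eventually)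
    qed
    show "\<forall>\<^sub>F s in at_top. AE x in lebesgue. norm (indicator (A (max a s)) x :: real) \<le> indicator {1..4} x"
      by (auto simp: A_def indicator_def)
    show "(indicator (A (max a t)) :: real \<Rightarrow> real) \<in> borel_measurable lebesgue" for t
      using Asets[of "max a t"] by (intro borel_measurable_indicator) auto
  qed (auto intro!: integrable_real_indicator borel_measurable_indicator)
  have "\<forall>\<^sub>F s in at_top. measure lebesgue (A (max a s)) > 8/3"
    using order_tendstoD(1)[OF conv, of "8/3"] by simp
  then have "\<forall>\<^sub>F s in at_top. s \<ge> a \<and> measure lebesgue (A s) > 8/3"
    using eventually_ge_at_top[of a] by eventually_elim (simp add: max_def split: if_splits)
  then obtain X where X: "\<And>s. s \<ge> X \<Longrightarrow> s \<ge> a \<and> measure lebesgue (A s) > 8/3"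
    by (auto simp: eventually_at_top_linorder)
  show thesis
  proof
    show "X \<ge> a" using X by auto
    show "L * L > 0" using L by simp
    fix s m :: real assume s: "s \<ge> X" and m: "1 \<le> m" "m \<le> 2"
    have "1 * s \<le> m * s" using s m X[of s] a by (intro mult_right_mono) auto
    then have ms: "m * s \<ge> X" using s by simp
    have "A r \<subseteq> {1..4}" for r by (auto simp: A_def)
    then obtain w where w: "w \<in> A (m * s)" "m * w \<in> A s"
      using dilation_overlap[of "A s" "A (m * s)" m] Asets X s ms m by blast
    have eq: "w * (m * s) = m * w * s" by simp
    have "R (m * s) \<le> L * R (m * w * s)" "R (m * w * s) \<le> L * R s"
        "R s \<le> L * R (m * w * s)" "R (m * w * s) \<le> L * R (m * s)"
      using w unfolding A_def mem_Collect_eq eq by auto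
    then show "R (m * s) \<le> L * L * R s \<and> R s \<le> L * L * R (m * s)"
      using L by (smt (verit) mult.assoc mult_left_mono)
  qed
qed

section \<open>Potter-type bounds\<close>

text \<open>
  Halving \<open>y\<close> costs a factor \<open>D\<close>, which the halving of \<open>(y / x) ^ p\<close> by \<open>2 ^ p \<ge> D\<close> absorbs.  Hence
  the constant in front stays \<open>D\<close> throughout the induction.
\<close>

lemma potter_of_doubling:
  fixes f :: "real \<Rightarrow> real"
  assumes X: "X > 0" and pos: "\<And>s. s \<ge> X \<Longrightarrow> f s > 0"
    and D: "D > 0" "D \<le> 2 ^ p"
    and near: "\<And>s m. \<lbrakk>s \<ge> X; 1 \<le> m; m \<le> 2\<rbrakk> \<Longrightarrow> f (m * s) \<le> D * f s"
    and xy: "X \<le> x" "x \<le> y"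
  shows "f y \<le> D * (y / x) ^ p * f x"
proof -
  have claim: "f y \<le> D * (y / x) ^ p * f x" if "x \<le> y" "y \<le> 2 ^ n * x" for n y
    using that
  proof (induction n arbitrary: y)
    case (Suc n)
    have x: "x > 0" "f x > 0" using X xy pos by auto
    show ?case
    proof (cases "y \<le> 2 * x")
      case True
      have "f y \<le> D * f x"
        using near[of x "y/x"] True Suc.prems x xy by (auto simp: field_simps)
      also have "\<dots> \<le> D * (y / x) ^ p * f x"
        using D x Suc.prems by (intro mult_right_mono) (auto intro!: one_le_power)
      finally show ?thesis .
    next
      case False
      have "f (2 * (y/2)) \<le> D * f (y / 2)" using False xy x by (intro near) auto
      also have "\<dots> \<le> 2 ^ p * f (y / 2)"
        using D pos[of "y/2"] False xy x by (intro mult_right_mono) auto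
      also have "\<dots> \<le> 2 ^ p * (D * (y / 2 / x) ^ p * f x)"
        using Suc.IH[of "y/2"] False Suc.prems by (intro mult_left_mono) auto
      also have "\<dots> = D * (y / x) ^ p * f x"
        by (simp add: power_divide field_simps)
      finally show ?thesis by simp
    qed
  next
    case 0
    then have "y = x" by simp
    then show ?case using near[of x 1] xy X by simp
  qed
  obtain n where "y / x < 2 ^ n" using real_arch_pow[of 2 "y/x"] by auto
  then have "y \<le> 2 ^ n * x" using X xy by (simp add: field_simps)
  then show ?thesis using claim xy by blast
qed


text \<open>
  The lower bound is the upper bound for \<open>1 / R\<close>.
\<close>

lemma regularly_varying_potter:
  assumes rv: "regularly_varying a \<beta> R"
  obtains D X p where "D > 0" "X \<ge> a"
    "\<And>x y. \<lbrakk>X \<le> x; x \<le> y\<rbrakk> \<Longrightarrow> R y \<le> D * (y / x) ^ p * R x \<and> R x \<le> D * (y / x) ^ p * R y"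
proof -
  have a: "a > 0" and pos: "\<And>s. s \<ge> a \<Longrightarrow> R s > 0"
    using rv by (auto simp: regularly_varying_def)
  obtain D X where D: "D > 0" and X: "X \<ge> a"
    and near: "\<And>s m. \<lbrakk>s \<ge> X; 1 \<le> m; m \<le> 2\<rbrakk> \<Longrightarrow> R (m * s) \<le> D * R s \<and> R s \<le> D * R (m * s)"
    using regularly_varying_comparable_nearby[OF rv] by metis
  obtain p where p: "D < 2 ^ p" using real_arch_pow[of 2 D] by auto
  have posX: "R s > 0" if "s \<ge> X" for s using pos that X by simp
  show thesis
  proof
    show "D > 0" "X \<ge> a" by fact+
    fix x y assume xy: "X \<le> x" "x \<le> y"
    have up: "R y \<le> D * (y / x) ^ p * R x"
      using potter_of_doubling[of X R D p x y] near posX X a D p xy by auto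
    have inv: "1 / R y \<le> D * (y / x) ^ p * (1 / R x)"
    proof (rule potter_of_doubling[of X "\<lambda>s. 1 / R s"])
      fix s m assume sm: "s \<ge> X" "1 \<le> m" "m \<le> (2::real)"
      have "1 * s \<le> m * s" using sm X a by (intro mult_right_mono) auto
      then have "m * s \<ge> X" using sm by simp
      then show "1 / R (m * s) \<le> D * (1 / R s)"
        using near[OF sm] posX[OF sm(1)] posX[of "m * s"] by (simp add: field_simps)
    qed (use posX X a D p xy in auto)
    have "R x \<le> c * R y" if "1 / R y \<le> c * (1 / R x)" for c
      using that posX[of x] posX[of y] xy by (simp add: field_simps)
    with up inv show "R y \<le> D * (y / x) ^ p * R x \<and> R x \<le> D * (y / x) ^ p * R y" by blast
  qed
qed

text \<open>
  The symmetric weight \<open>(k / x) ^ p + (x / k) ^ p\<close> covers \<open>k \<le> x\<close> and \<open>x \<le> k\<close> at once.  Only finitely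
  many integers \<open>k\<close> lie between \<open>N\<close> and the threshold \<open>X\<close> from which the Potter bounds hold.  For
  those, \<open>R k\<close> is comparable to \<open>R X\<close>, and \<open>x / X \<le> x / k\<close>.
\<close>

lemma regularly_varying_comparable_at_nats:
  assumes rv: "regularly_varying a \<beta> R" and N: "a \<le> real N"
  obtains D X p where "D > 0" "X \<ge> a"
    "\<And>k x. \<lbrakk>k \<ge> N; x \<ge> X\<rbrakk> \<Longrightarrow>
       R (real k) \<le> D * ((real k / x) ^ p + (x / real k) ^ p) * R x \<and>
       R x \<le> D * ((real k / x) ^ p + (x / real k) ^ p) * R (real k)"
proof -
  have a: "a > 0" and pos: "\<And>s. s \<ge> a \<Longrightarrow> R s > 0"
    using rv by (auto simp: regularly_varying_def)
  obtain D X p where D: "D > 0" and X: "X \<ge> a"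
    and pot: "\<And>x y. \<lbrakk>X \<le> x; x \<le> y\<rbrakk> \<Longrightarrow> R y \<le> D * (y / x) ^ p * R x \<and> R x \<le> D * (y / x) ^ p * R y"
    using regularly_varying_potter[OF rv] by metis
  define F where "F = {k. N \<le> k \<and> real k < X}"
  define M where "M = 1 + (\<Sum>k\<in>F. R (real k) / R X + R X / R (real k))"
  have finF: "finite F"
    by (rule finite_subset[of _ "{..nat \<lceil>X\<rceil>}"]) (auto simp: F_def, linarith)
  have posN: "R (real k) > 0" if "k \<ge> N" for k using pos[of "real k"] that N by simp
  have RX: "R X > 0" using pos X by simp
  have nonneg: "0 \<le> R (real k) / R X + R X / R (real k)" if "k \<in> F" for k
    using posN[of k] RX that by (auto simp: F_def)
  have M1: "M \<ge> 1" unfolding M_def using nonneg by (simp add: sum_nonneg)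
  have M: "R (real k) \<le> M * R X \<and> R X \<le> M * R (real k)" if k: "k \<in> F" for k
  proof -
    have pk: "R (real k) > 0" using posN k by (auto simp: F_def)
    have "R (real k) / R X + R X / R (real k) \<le> M"
      unfolding M_def using member_le_sum[OF k, of "\<lambda>k. R (real k) / R X + R X / R (real k)"] nonneg finF
      by (smt (verit) DiffD1)
    moreover have "R (real k) / R X > 0" "R X / R (real k) > 0" using pk RX by auto
    ultimately have "R (real k) / R X \<le> M" "R X / R (real k) \<le> M" by linarith+
    then show ?thesis using pk RX by (simp add: field_simps)
  qed
  show thesis
  proof
    show "D * M > 0" using D M1 by simp
    show "X \<ge> a" by fact
    fix k :: nat and x :: real assume k: "k \<ge> N" and x: "x \<ge> X"
    let ?\<phi> = "(real k / x) ^ p + (x / real k) ^ p"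
    have kx: "real k > 0" "x > 0" using k x N X a by auto
    have le: "(real k / x) ^ p \<le> ?\<phi>" "(x / real k) ^ p \<le> ?\<phi>" using kx by auto
    have Rpos: "R (real k) > 0" "R x > 0" using posN k pos x X by auto
    \<comment> \<open>Each case below yields the bound with a factor \<open>q \<le> M * ?\<phi>\<close>.\<close>
    have wrap: "u \<le> D * M * ?\<phi> * v" if "u \<le> D * q * v" "q \<le> M * ?\<phi>" "v > 0" for u v q
    proof -
      have "D * q * v \<le> D * (M * ?\<phi>) * v" using that D by (intro mult_right_mono mult_left_mono) auto
      then show ?thesis using that by (simp add: mult.assoc)
    qed
    have phi: "?\<phi> \<le> M * ?\<phi>" using M1 kx mult_right_mono[of 1 M ?\<phi>] by auto
    consider "real k < X" | "X \<le> real k" "real k \<le> x" | "x \<le> real k" using x by linarith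
    then show "R (real k) \<le> D * M * ?\<phi> * R x \<and> R x \<le> D * M * ?\<phi> * R (real k)"
    proof cases
      case 1
      then have kM: "R (real k) \<le> M * R X" "R X \<le> M * R (real k)" using M k by (auto simp: F_def)
      have "(x / X) ^ p \<le> (x / real k) ^ p"
        using 1 kx by (intro power_mono divide_left_mono) auto
      then have q: "M * (x / X) ^ p \<le> M * ?\<phi>"
        using le M1 by (intro mult_left_mono) auto
      have "M * R X \<le> M * (D * (x / X) ^ p * R x)"
        using pot[of X x] x M1 by (intro mult_left_mono) auto
      then have "R (real k) \<le> D * (M * (x / X) ^ p) * R x" using kM by (simp add: ac_simps)
      moreover have "D * (x / X) ^ p * R X \<le> D * (x / X) ^ p * (M * R (real k))"
        using kM D kx 1 by (intro mult_left_mono) auto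
      then have "R x \<le> D * (M * (x / X) ^ p) * R (real k)"
        using pot[of X x] x by (auto simp add: ac_simps)
      ultimately show ?thesis using wrap[OF _ q] Rpos by blast
    next
      case 2
      then show ?thesis using pot[of "real k" x] wrap[of _ "(x / real k) ^ p"] le phi Rpos by force
    next
      case 3
      then show ?thesis using pot[of x "real k"] wrap[of _ "(real k / x) ^ p"] le phi Rpos x by force
    qed
  qed
qed

section \<open>Moments of the exponential series\<close>

lemma has_sum_exp:
  fixes x :: real assumes "x \<ge> 0"
  shows "((\<lambda>k. x ^ k / fact k) has_sum exp x) UNIV"
  using exp_converges[of x] assms
  by (intro sums_nonneg_imp_has_sum) (auto simp: divide_inverse mult.commute)

lemma exp_partial_sum_le:
  fixes x :: real assumes "x \<ge> 0" "finite F"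
  shows "(\<Sum>k\<in>F. x ^ k / fact k) \<le> exp x"
  using finite_sum_le_has_sum[OF has_sum_exp[OF assms(1)] assms(2)] assms by auto

lemma power_le_fact_exp:
  fixes u :: real assumes "u \<ge> 0"
  shows "u ^ p \<le> fact p * exp u"
  using exp_partial_sum_le[OF assms, of "{p}"] by (simp add: field_simps)

lemma fact_add_le:
  assumes "k \<ge> 1"
  shows "(fact (k + p) :: real) \<le> fact (p + 1) * real k ^ p * fact k"
proof (induction p)
  case (Suc p)
  have "k + Suc p \<le> (p + 2) * k" using assms by (cases k) auto
  then have "real (k + Suc p) \<le> real (p + 2) * real k" by (metis of_nat_le_iff of_nat_mult)
  then have "real (k + Suc p) * fact (k + p)
      \<le> (real (p + 2) * real k) * (fact (p + 1) * real k ^ p * fact k)"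
    using Suc by (intro mult_mono) auto
  then show ?case by (simp add: algebra_simps)
qed simp

text \<open>
  A Poisson variable of mean \<open>x\<close> has moments of order \<open>p\<close> and \<open>- p\<close>, relative to its mean, that stay
  bounded as \<open>x\<close> grows.  For the positive order, \<open>(k / x) ^ p \<le> fact p * exp (k / x)\<close> produces an
  exponential series at \<open>x * exp (1 / x) \<le> x + 2\<close>.  For the negative order, \<open>k ^ p * fact k\<close> is at
  least a constant times \<open>fact (k + p)\<close>, which shifts the exponential series by \<open>p\<close>.
\<close>

lemma poisson_moment_bound:
  fixes x :: real
  assumes x: "x \<ge> 1" and F: "finite F" "F \<subseteq> {1..}"
  shows "(\<Sum>k\<in>F. x ^ k / fact k * ((real k / x) ^ p + (x / real k) ^ p))
           \<le> (fact p * exp 2 + fact (p + 1)) * exp x"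
proof -
  have "(\<Sum>k\<in>F. x ^ k / fact k * (real k / x) ^ p)
      \<le> (\<Sum>k\<in>F. fact p * ((x * exp (1 / x)) ^ k / fact k))"
  proof (rule sum_mono)
    fix k
    have "x ^ k / fact k * (real k / x) ^ p \<le> x ^ k / fact k * (fact p * exp (real k / x))"
      using power_le_fact_exp[of "real k / x" p] x by (intro mult_left_mono) auto
    also have "exp (real k / x) = exp (1 / x) ^ k"
      using exp_of_nat_mult[of k "1 / x"] by simp
    finally show "x ^ k / fact k * (real k / x) ^ p \<le> fact p * ((x * exp (1 / x)) ^ k / fact k)"
      by (simp add: power_mult_distrib mult_ac)
  qed
  also have "\<dots> = fact p * (\<Sum>k\<in>F. (x * exp (1 / x)) ^ k / fact k)"
    by (simp add: sum_distrib_left)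
  also have "\<dots> \<le> fact p * exp (x * exp (1 / x))"
    using x F by (intro mult_left_mono exp_partial_sum_le) auto
  also have "\<dots> \<le> fact p * exp (x + 2)"
  proof -
    have "exp (1 / x) \<le> 1 + 1 / x + (1 / x)\<^sup>2" using x by (intro exp_bound) auto
    also have "(1 / x)\<^sup>2 \<le> 1 / x" using x by (simp add: power2_eq_square field_simps)
    finally have "x * exp (1 / x) \<le> x * (1 + 1 / x + 1 / x)" using x by (intro mult_left_mono) auto
    also have "\<dots> = x + 2" using x by (simp add: field_simps)
    finally show ?thesis by simp
  qed
  finally have up: "(\<Sum>k\<in>F. x ^ k / fact k * (real k / x) ^ p) \<le> fact p * exp 2 * exp x"
    by (simp add: exp_add mult_ac)
  have "(\<Sum>k\<in>F. x ^ k / fact k * (x / real k) ^ p)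
      \<le> (\<Sum>k\<in>F. fact (p + 1) * (x ^ (k + p) / fact (k + p)))"
  proof (rule sum_mono)
    fix k assume "k \<in> F"
    then have k: "k \<ge> 1" using F by auto
    have "x ^ (k + p) * fact (k + p) \<le> x ^ (k + p) * (fact (p + 1) * real k ^ p * fact k)"
      using fact_add_le[OF k, of p] x by (intro mult_left_mono) auto
    then show "x ^ k / fact k * (x / real k) ^ p \<le> fact (p + 1) * (x ^ (k + p) / fact (k + p))"
      using k by (simp add: power_divide power_add divide_simps mult_ac del: fact_Suc)
  qed
  also have "\<dots> = fact (p + 1) * (\<Sum>j\<in>(\<lambda>k. k + p) ` F. x ^ j / fact j)"
    by (simp add: sum_distrib_left sum.reindex)
  also have "\<dots> \<le> fact (p + 1) * exp x"
    using x F by (intro mult_left_mono exp_partial_sum_le) auto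
  finally show ?thesis using up
    by (simp add: algebra_simps sum.distrib)
qed

text \<open>
  The \<open>N\<close> omitted terms are powers of \<open>x\<close>, negligible against \<open>exp x\<close>.
\<close>

lemma exp_tail_ge_half:
  "\<forall>\<^sub>F x in at_top. exp x / 2 \<le> (\<Sum>\<^sub>\<infinity>k\<in>{N..}. x ^ k / fact k :: real)"
proof -
  have "((\<lambda>x. \<Sum>k<N. (1 / fact k) * (x ^ k / exp x)) \<longlongrightarrow> (\<Sum>k<N. (1 / fact k) * 0 :: real)) at_top"
    by (intro tendsto_intros tendsto_power_div_exp_0)
  then have "\<forall>\<^sub>F x in at_top. (\<Sum>k<N. (1 / fact k) * (x ^ k / exp x)) < (1/2 :: real)"
    by (rule order_tendstoD) simp
  then show ?thesis using eventually_ge_at_top[of 0]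
  proof eventually_elim
    case (elim x)
    have "(\<Sum>k<N. (1 / fact k) * (x ^ k / exp x)) = (\<Sum>k<N. x ^ k / fact k) / exp x"
      by (simp add: sum_divide_distrib)
    then have "(\<Sum>k<N. x ^ k / fact k) / exp x < 1 / 2" using elim(1) by metis
    then have head: "(\<Sum>k<N. x ^ k / fact k) \<le> exp x / 2"
      by (subst (asm) pos_divide_less_eq) auto
    have "((\<lambda>k. x ^ k / fact k) has_sum exp x - (\<Sum>k<N. x ^ k / fact k)) (UNIV - {..<N})"
      by (rule has_sum_Diff[OF has_sum_exp]) (use elim in auto)
    moreover have "UNIV - {..<N} = {N..}" by auto
    ultimately have "(\<Sum>\<^sub>\<infinity>k\<in>{N..}. x ^ k / fact k) = exp x - (\<Sum>k<N. x ^ k / fact k)"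
      by (metis infsumI)
    then show ?case using head by simp
  qed
qed


lemma poisson_moment_infsum:
  fixes x :: real
  assumes x: "x \<ge> 1" and N: "N \<ge> 1"
  shows "(\<lambda>k. x ^ k / fact k * ((real k / x) ^ p + (x / real k) ^ p)) summable_on {N..}"
    and "(\<Sum>\<^sub>\<infinity>k\<in>{N..}. x ^ k / fact k * ((real k / x) ^ p + (x / real k) ^ p))
           \<le> (fact p * exp 2 + fact (p + 1)) * exp x"
proof -
  have sub: "F \<subseteq> {1..}" if "F \<subseteq> {N..}" for F using that N by auto
  show s: "(\<lambda>k. x ^ k / fact k * ((real k / x) ^ p + (x / real k) ^ p)) summable_on {N..}"
  proof (rule nonneg_bdd_above_summable_on)
    show "bdd_above (sum (\<lambda>k. x ^ k / fact k * ((real k / x) ^ p + (x / real k) ^ p)) `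
            {F. F \<subseteq> {N..} \<and> finite F})"
      by (rule bdd_aboveI2, rule poisson_moment_bound[OF x]) (use sub in auto)
  qed (use x in auto)
  show "(\<Sum>\<^sub>\<infinity>k\<in>{N..}. x ^ k / fact k * ((real k / x) ^ p + (x / real k) ^ p))
           \<le> (fact p * exp 2 + fact (p + 1)) * exp x"
    by (rule infsum_le_finite_sums[OF s], rule poisson_moment_bound[OF x]) (use sub in auto)
qed

section \<open>Averages of comparable sequences\<close>

text \<open>
  The line on the left is the tangent at \<open>B\<close> of the convex function \<open>1 / u\<close>.  Bounding \<open>1 / u\<close>
  below by an affine function of \<open>u\<close> lets an upper bound on a mean of \<open>u\<close> give a lower bound on the
  mean of \<open>1 / u\<close>.
\<close>

lemma inverse_ge_tangent:
  fixes B u :: real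
  assumes "B > 0" "u > 0"
  shows "2 / B - u / B\<^sup>2 \<le> 1 / u"
proof -
  have "1 / u - (2 / B - u / B\<^sup>2) = (B - u)\<^sup>2 / (u * B\<^sup>2)"
    using assms by (simp add: field_simps power2_eq_square)
  also have "\<dots> \<ge> 0" using assms by simp
  finally show ?thesis by simp
qed

text \<open>
  Write \<open>w\<close> for the exponential weights and \<open>\<phi>\<close> for the symmetric weight.  The upper bound is the
  moment bound for \<open>\<phi>\<close>.  For the lower bound, \<open>r k \<ge> \<rho> / (D * \<phi> k)\<close>, and the tangent of \<open>1 / u\<close> at
  \<open>u = 2 B\<close> reduces the sum of \<open>w / \<phi>\<close> to the sums of \<open>w\<close> (at least \<open>exp x / 2\<close>) and of \<open>w \<phi>\<close>
  (at most \<open>B exp x\<close>): the result is at least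
  \<open>(1 / (2 B) - B / (2 B)\<^sup>2) exp x = exp x / (4 B)\<close>.
\<close>

lemma poisson_sum_of_comparable:
  fixes r :: "nat \<Rightarrow> real" and x \<rho> D :: real
  assumes x: "x \<ge> 1" and N: "N \<ge> 1" and D: "D > 0" and pos: "\<rho> > 0" "\<And>k. k \<ge> N \<Longrightarrow> r k > 0"
    and cmp: "\<And>k. k \<ge> N \<Longrightarrow> r k \<le> D * ((real k / x) ^ p + (x / real k) ^ p) * \<rho> \<and>
                              \<rho> \<le> D * ((real k / x) ^ p + (x / real k) ^ p) * r k"
    and tail: "exp x / 2 \<le> (\<Sum>\<^sub>\<infinity>k\<in>{N..}. x ^ k / fact k)"
  defines "B \<equiv> fact p * exp 2 + fact (p + 1)"
  shows "(\<lambda>k. x ^ k / fact k * r k) summable_on {N..}"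
    and "(\<Sum>\<^sub>\<infinity>k\<in>{N..}. x ^ k / fact k * r k) \<le> D * B * (\<rho> * exp x)"
    and "\<rho> * exp x / (4 * D * B) \<le> (\<Sum>\<^sub>\<infinity>k\<in>{N..}. x ^ k / fact k * r k)"
proof -
  define w :: "nat \<Rightarrow> real" where "w = (\<lambda>k. x ^ k / fact k)"
  define \<phi> where "\<phi> = (\<lambda>k::nat. (real k / x) ^ p + (x / real k) ^ p)"
  have w: "w k \<ge> 0" for k using x by (simp add: w_def)
  have \<phi>: "\<phi> k > 0" if "k \<ge> N" for k using x N that by (auto simp: \<phi>_def intro!: add_pos_pos)
  have B: "B > 0" by (auto simp: B_def intro!: add_pos_pos)
  have sw: "w summable_on {N..}"
    using has_sum_exp[of x] x summable_on_subset_banach[of w UNIV "{N..}"]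
    by (auto simp: w_def summable_on_def)
  have s\<phi>: "(\<lambda>k. w k * \<phi> k) summable_on {N..}" and i\<phi>: "(\<Sum>\<^sub>\<infinity>k\<in>{N..}. w k * \<phi> k) \<le> B * exp x"
    using poisson_moment_infsum[OF x N, of p] by (simp_all add: w_def \<phi>_def B_def)
  have up: "w k * r k \<le> D * \<rho> * (w k * \<phi> k)" if "k \<in> {N..}" for k
    using mult_left_mono[OF conjunct1[OF cmp[of k]] w[of k]] that by (simp add: \<phi>_def mult_ac)
  have s: "(\<lambda>k. w k * r k) summable_on {N..}"
  proof (rule summable_on_comparison_test)
    show "(\<lambda>k. D * \<rho> * (w k * \<phi> k)) summable_on {N..}" using s\<phi> by (rule summable_on_cmult_right)
    show "0 \<le> w k * r k" if "k \<in> {N..}" for k using that w pos(2)[of k] by auto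
  qed (rule up)
  then show "(\<lambda>k. x ^ k / fact k * r k) summable_on {N..}" by (simp add: w_def)
  have "(\<Sum>\<^sub>\<infinity>k\<in>{N..}. w k * r k) \<le> (\<Sum>\<^sub>\<infinity>k\<in>{N..}. D * \<rho> * (w k * \<phi> k))"
    by (intro infsum_mono s summable_on_cmult_right s\<phi> up)
  also have "\<dots> = D * \<rho> * (\<Sum>\<^sub>\<infinity>k\<in>{N..}. w k * \<phi> k)" by (rule infsum_cmult_right')
  also have "\<dots> \<le> D * \<rho> * (B * exp x)" using i\<phi> D pos by (intro mult_left_mono) auto
  finally show "(\<Sum>\<^sub>\<infinity>k\<in>{N..}. x ^ k / fact k * r k) \<le> D * B * (\<rho> * exp x)"
    by (simp add: w_def mult_ac)

  \<comment> \<open>Coefficients of the tangent of \<open>1 / u\<close> at \<open>u = 2 * B\<close>.\<close>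
  let ?c = "2 / (2 * B)" and ?d = "- (1 / (2 * B)\<^sup>2)"
  have lo: "\<rho> / D * (?c * w k + ?d * (w k * \<phi> k)) \<le> w k * r k" if k: "k \<in> {N..}" for k
  proof -
    have pk: "\<phi> k > 0" using \<phi> k by simp
    have "?c * w k + ?d * (w k * \<phi> k) = w k * (2 / (2 * B) - \<phi> k / (2 * B)\<^sup>2)"
      by (simp add: algebra_simps)
    also have "\<dots> \<le> w k * (1 / \<phi> k)"
      using inverse_ge_tangent[of "2 * B" "\<phi> k"] B pk w by (intro mult_left_mono) auto
    finally have "\<rho> / D * (?c * w k + ?d * (w k * \<phi> k)) \<le> \<rho> / D * (w k * (1 / \<phi> k))"
      using D pos by (intro mult_left_mono) auto
    also have "\<dots> = w k * (\<rho> / (D * \<phi> k))" by simp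
    also have "\<dots> \<le> w k * r k"
    proof (rule mult_left_mono[OF _ w])
      have "\<rho> \<le> D * \<phi> k * r k" using cmp[of k] k by (simp add: \<phi>_def)
      then show "\<rho> / (D * \<phi> k) \<le> r k" using D pk by (simp add: pos_divide_le_eq mult_ac)
    qed
    finally show ?thesis .
  qed
  have sc: "(\<lambda>k. ?c * w k) summable_on {N..}" "(\<lambda>k. ?d * (w k * \<phi> k)) summable_on {N..}"
    by (intro summable_on_cmult_right sw s\<phi>)+
  have "\<rho> * exp x / (4 * D * B) = \<rho> / D * (?c * (exp x / 2) + ?d * (B * exp x))"
    using B D by (simp add: field_simps power2_eq_square)
  also have "\<dots> \<le> \<rho> / D * (?c * (\<Sum>\<^sub>\<infinity>k\<in>{N..}. w k) + ?d * (\<Sum>\<^sub>\<infinity>k\<in>{N..}. w k * \<phi> k))"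
    using tail i\<phi> B D pos
    by (intro mult_left_mono add_mono mult_left_mono_neg) (auto simp: w_def)
  also have "\<dots> = (\<Sum>\<^sub>\<infinity>k\<in>{N..}. \<rho> / D * (?c * w k + ?d * (w k * \<phi> k)))"
    using sc by (simp only: infsum_cmult_right' infsum_add)
  also have "\<dots> \<le> (\<Sum>\<^sub>\<infinity>k\<in>{N..}. w k * r k)"
    by (intro infsum_mono s summable_on_cmult_right summable_on_add sc lo)
  finally show "\<rho> * exp x / (4 * D * B) \<le> (\<Sum>\<^sub>\<infinity>k\<in>{N..}. x ^ k / fact k * r k)"
    by (simp add: w_def)
qed

section \<open>Exponential sums of regularly varying sequences\<close>

theorem theorem2:
  fixes N :: nat and N0 \<alpha> \<beta> :: real and R :: "real \<Rightarrow> real"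
  assumes "N > 0"
    and "\<alpha> > 0"
    and "0 < N0"
    and "N0 \<le> real N"
    and "regularly_varying N0 \<beta> R"
  shows "(\<exists>C>0. \<exists>t0>0. N0 \<le> \<alpha> * t0 \<and>
           (\<forall>t\<ge>t0.
              (\<lambda>k. (\<alpha> * t) ^ k / fact k * R (real k)) summable_on {N..} \<and>
              (1 / C) * (R (\<alpha> * t) * exp (\<alpha> * t))
                \<le> (\<Sum>\<^sub>\<infinity>k\<in>{N..}. (\<alpha> * t) ^ k / fact k * R (real k)) \<and>
              (\<Sum>\<^sub>\<infinity>k\<in>{N..}. (\<alpha> * t) ^ k / fact k * R (real k))
                \<le> C * (R (\<alpha> * t) * exp (\<alpha> * t))))
       \<and> same_order
           (\<lambda>t. \<Sum>\<^sub>\<infinity>k\<in>{N..}. (\<alpha> * t) ^ k / fact k * R (real k))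
           (\<lambda>t. R (\<alpha> * t) * exp (\<alpha> * t))"
proof -
  define S where "S = (\<lambda>t. \<Sum>\<^sub>\<infinity>k\<in>{N..}. (\<alpha> * t) ^ k / fact k * R (real k))"
  obtain D X p where D: "D > 0" and X: "X \<ge> N0"
    and cmp: "\<And>k x. \<lbrakk>k \<ge> N; x \<ge> X\<rbrakk> \<Longrightarrow>
       R (real k) \<le> D * ((real k / x) ^ p + (x / real k) ^ p) * R x \<and>
       R x \<le> D * ((real k / x) ^ p + (x / real k) ^ p) * R (real k)"
    using regularly_varying_comparable_at_nats[OF assms(5,4)] by metis
  obtain Y :: real where Y: "\<And>x. x \<ge> Y \<Longrightarrow> exp x / 2 \<le> (\<Sum>\<^sub>\<infinity>k\<in>{N..}. x ^ k / fact k)"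
    using exp_tail_ge_half[of N] by (auto simp: eventually_at_top_linorder)
  define B :: real where "B = fact p * exp 2 + fact (p + 1)"
  define t0 where "t0 = max (max X Y) 1 / \<alpha>"
  define C where "C = 4 * D * B"
  have B: "B > 0" by (auto simp: B_def intro!: add_pos_pos)
  have C: "C > 0" using B D by (simp add: C_def)
  have t0: "t0 > 0" "N0 \<le> \<alpha> * t0" using assms(2) X by (auto simp: t0_def)
  have main: "(\<lambda>k. (\<alpha> * t) ^ k / fact k * R (real k)) summable_on {N..} \<and>
      (1 / C) * (R (\<alpha> * t) * exp (\<alpha> * t)) \<le> S t \<and> S t \<le> C * (R (\<alpha> * t) * exp (\<alpha> * t))"
    if t: "t \<ge> t0" for t
  proof -
    have "\<alpha> * t0 \<le> \<alpha> * t" using t assms(2) by simp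
    then have x: "\<alpha> * t \<ge> X" "\<alpha> * t \<ge> Y" "\<alpha> * t \<ge> 1" using assms(2) by (auto simp: t0_def)
    have posR: "R s > 0" if "s \<ge> N0" for s
      using assms(5) that by (simp add: regularly_varying_def)
    have Rpos: "R (\<alpha> * t) > 0" "\<And>k. k \<ge> N \<Longrightarrow> R (real k) > 0"
      using posR x X assms(4) by auto
    have N: "N \<ge> 1" using assms(1) by simp
    note bounds = poisson_sum_of_comparable[OF x(3) N D Rpos cmp[OF _ x(1)] Y[OF x(2)], folded B_def]
    have "S t \<le> D * B * (R (\<alpha> * t) * exp (\<alpha> * t))" using bounds(2) by (simp only: S_def)
    also have "\<dots> \<le> C * (R (\<alpha> * t) * exp (\<alpha> * t))"
      unfolding C_def using D B Rpos by (intro mult_right_mono) auto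
    finally show ?thesis using bounds(1,3) by (simp add: S_def C_def)
  qed
  have "same_order S (\<lambda>t. R (\<alpha> * t) * exp (\<alpha> * t))"
    unfolding same_order_def using main C t0(1) by blast
  moreover have "\<exists>C>0. \<exists>t0>0. N0 \<le> \<alpha> * t0 \<and>
      (\<forall>t\<ge>t0. (\<lambda>k. (\<alpha> * t) ^ k / fact k * R (real k)) summable_on {N..} \<and>
        (1 / C) * (R (\<alpha> * t) * exp (\<alpha> * t)) \<le> S t \<and> S t \<le> C * (R (\<alpha> * t) * exp (\<alpha> * t)))"
    using main C t0 by blast
  ultimately show ?thesis unfolding S_def by blast
qed

end
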